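(* Let $(W^{\mathrm{opt}_3},(U_{ik}^{\mathrm{opt}_3})_{(i,k)\in\hat{\mathcal E}_s})$ be an optimal solution of problem (P3), let $W_{ik}^{\mathrm{opt}_3}$ be the $2\times2$ principal submatrix of $W^{\mathrm{opt}_3}$ on rows and columns $i,k$, let $$\hat\alpha_{ik}=\operatorname{Tr}\{U_{ik}^{\mathrm{opt}_3}\}/\operatorname{Tr}\{W_{ik}^{\mathrm{opt}_3}\}\in[0,1],\qquad (i,k)\in\hat{\mathcal E}_s,$$ and let $\hat\alpha_r\in\{0,1\}^{|\hat{\mathcal E}_s|}$ be obtained from $\hat\alpha$ by rounding each entry to the closest number in $\{0,1\}$. Let $p_1^{\mathrm{opt}}$, $p_2^{\mathrm{opt}}$, $p_3^{\mathrm{opt}}$ be the optimal values of (P1)-$\hat\alpha_r$, (P2) and (P3), respectively. Then $$p_1^{\mathrm{opt}}\ge p_2^{\mathrm{opt}}\ge p_3^{\mathrm{opt}}.$$ Moreover, if $p_1^{\mathrm{opt}}=p_3^{\mathrm{opt}}$, then the optimal solution $W_1^{\mathrm{opt}}$ of (P1)-$\hat\alpha_r$, combined with $\hat\alpha_r$, is an optimal solution of (P2).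
   Context: Notation: $j$ is the imaginary unit, $A^*$ is the conjugate transpose (conjugate, for scalars), $\operatorname{Tr}$ is the trace, $A\succeq 0$ means Hermitian positive semidefinite, $e_1,\dots,e_N$ is the canonical basis of $\mathbb R^N$. The optimal value of an infeasible minimization problem is $+\infty$. Network: $\mathcal N=\mathcal N_G\cup\mathcal N_L$ is a finite set of $N$ buses (generation and load buses). The set of lines is an undirected simple edge set $\mathcal E_0$ divided into disjoint sets $\mathcal E_s$ (switchable lines) and $\mathcal E$ (non-switchable lines); $\hat{\mathcal E}_s$ is an arbitrary orientation of $\mathcal E_s$ (exactly one ordered pair for each line). Let $\mathcal S_i=\{k:\{i,k\}\in\mathcal E_s\}$. Each line has admittance $y_{ik}=y_{ki}\in\mathbb C$. Let $\mathbf Y\in\mathbb C^{N\times N}$ be the admittance matrix of the network with the non-switchable lines and $$Y_i=\tfrac12\big((e_ie_i^\top\mathbf Y)^*+e_ie_i^\top\mathbf Y\big),\qquad \bar Y_i=\tfrac1{2j}\big((e_ie_i^\top\mathbf Y)^*-e_ie_i^\top\mathbf Y\big).$$ For a line $\{i,k\}\in\mathcal E_s$, $Y_{ik},\bar Y_{ik}\in\mathbb C^{N\times N}$ have all entries zero except $Y_{ik}(i,i)=\Re(y_{ik})$, $Y_{ik}(i,k)=Y_{ik}(k,i)^*=-y_{ik}/2$, $\bar Y_{ik}(i,i)=-\Im(y_{ik})$, $\bar Y_{ik}(i,k)=\bar Y_{ik}(k,i)^*=-j\,y_{ik}/2$; $Y_{ki},\bar Y_{ki}$ are given by the same formulas with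 $i$ and $k$ exchanged. The $2\times2$ matrices $\hat Y_{ik},\hat{\bar Y}_{ik}$ (and $\hat Y_{ki},\hat{\bar Y}_{ki}$) are their principal submatrices on the rows and columns of the two end nodes of the line, listed in the order given by the orientation $\hat{\mathcal E}_s$. Let $M_i=e_ie_i^\top$, $M_{ik}=(e_i-e_k)(e_i-e_k)^\top$ and $\hat M=\begin{bmatrix}1&-1\\-1&1\end{bmatrix}$. Data: real $P_{D_i},Q_{D_i}$, $\underline P_i,\overline P_i,\underline Q_i,\overline Q_i,\underline V_i,\overline V_i$ for $i\in\mathcal N$; $\overline V_{ik}\in\mathbb R$ for $\{i,k\}\in\mathcal E_0$; costs $c_{i2}\ge0$, $c_{i1}\in\mathbb R$ for $i\in\mathcal N_G$. Box constraints on $(W,P,Q)$: for all $i\in\mathcal N$, $\underline P_i\le P_i\le\overline P_i$, $\underline Q_i\le Q_i\le\overline Q_i$, $\underline V_i^2\le\operatorname{Tr}\{M_iW\}\le\overline V_i^2$; and for all $\{i,k\}\in\mathcal E_0$, $\operatorname{Tr}\{M_{ik}W\}\le\overline V_{ik}$. Problem (P2): minimize $\sum_{i\in\mathcal N_G}(c_{i2}P_i^2+c_{i1}P_i)$ over $W\in\mathbb C^{N\times N}$, $W\succeq0$, and $\alpha\in\{0,1\}^{|\mathcal E_s|}$ (one binary variable $\alpha_{ik}=\alpha_{ki}$ per switchable line), subject to the box constraints and, for all $i\in\mathcal N$, $P_i=\operatorname{Tr}\{Y_iW\}+P_{D_i}+\sum_{k\in\mathcal S_i}\alpha_{ik}\operatorname{Tr}\{Y_{ik}W\}$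 and $Q_i=\operatorname{Tr}\{\bar Y_iW\}+Q_{D_i}+\sum_{k\in\mathcal S_i}\alpha_{ik}\operatorname{Tr}\{\bar Y_{ik}W\}$. Problem (P1)-$\alpha$, for given $\alpha\in\{0,1\}^{|\mathcal E_s|}$: the same problem with $\alpha$ fixed and only $W\succeq0$ as decision variable (the semidefinite relaxation of optimal power flow for the network topology in which the switchable lines with $\alpha_{ik}=1$ are connected). Problem (P3): minimize $\sum_{i\in\mathcal N_G}(c_{i2}P_i^2+c_{i1}P_i)$ over $W\in\mathbb C^{N\times N}$, $W\succeq0$, and $U_{ik}\in\mathbb C^{2\times2}$, $U_{ik}\succeq 0$ for $(i,k)\in\hat{\mathcal E}_s$ (one matrix per switchable line), subject to the box constraints and: for all $i\in\mathcal N$: $P_i=\operatorname{Tr}\{Y_iW\}+P_{D_i}+\sum_{k\in\mathcal S_i}\operatorname{Tr}\{\hat Y_{ik}U_{ik}\}$, $Q_i=\operatorname{Tr}\{\bar Y_iW\}+Q_{D_i}+\sum_{k\in\mathcal S_i}\operatorname{Tr}\{\hat{\bar Y}_{ik}U_{ik}\}$ (here $U_{ik}$ denotes the matrix of the line $\{i,k\}$, whichever way it is oriented); for all $(i,k)\in\hat{\mathcal E}_s$: $U_{ik}(1,1)\le\operatorname{Tr}\{M_iW\}$, $U_{ik}(2,2)\le\operatorname{Tr}\{M_kW\}$, $\operatorname{Tr}\{\hat MU_{ik}\}\le\operatorname{Tr}\{M_{ik}W\}$. *)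

theory Defs
  imports "HOL-Analysis.Analysis"
begin

section \<open>Complex matrices\<close>

definition cadjoint :: "complex^'n^'m \<Rightarrow> complex^'m^'n" where
  "cadjoint A = (\<chi> a b. cnj (A $ b $ a))"

definition hermitian :: "complex^'n^'n \<Rightarrow> bool" where
  "hermitian A \<longleftrightarrow> cadjoint A = A"

definition psd :: "complex^'n^'n \<Rightarrow> bool" where
  "psd A \<longleftrightarrow> hermitian A \<and> (\<forall>x. 0 \<le> Re (\<Sum>a\<in>UNIV. cnj (x $ a) * (A *v x) $ a))"

definition cscale :: "complex \<Rightarrow> complex^'n^'m \<Rightarrow> complex^'n^'m" where
  "cscale c A = (\<chi> a b. c * A $ a $ b)"

definition outer :: "complex^'m \<Rightarrow> complex^'n \<Rightarrow> complex^'n^'m" where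
  "outer u v = (\<chi> a b. u $ a * v $ b)"

text \<open>All traces below are of products of two Hermitian matrices, hence real (lemma
  \<open>trace_hermitian_real\<close>); \<open>rtr A B\<close> is this trace as a real number.\<close>

definition rtr :: "complex^'n^'n \<Rightarrow> complex^'n^'n \<Rightarrow> real" where
  "rtr A B = Re (trace (A ** B))"

definition submat2 :: "'n \<Rightarrow> 'n \<Rightarrow> complex^'n^'n \<Rightarrow> complex^2^2" where
  "submat2 i k A = (\<chi> a b. A $ (if a = 1 then i else k) $ (if b = 1 then i else k))"

section \<open>Network data\<close>

text \<open>A line is the unordered pair \<open>{i, k}\<close> of its end nodes. Quantities belonging to a line are
  indexed by it, so that symmetry in \<open>i\<close> and \<open>k\<close> is built in. The buses are the
  elements of the type \<open>'n\<close>.\<close>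

record 'n network =
  gen_buses :: "'n set"
  load_buses :: "'n set"
  sw_lines :: "'n set set"
  fixed_lines :: "'n set set"
  orient :: "('n \<times> 'n) set"
  adm :: "'n set \<Rightarrow> complex"
  PD :: "'n \<Rightarrow> real"
  QD :: "'n \<Rightarrow> real"
  Pmin :: "'n \<Rightarrow> real"
  Pmax :: "'n \<Rightarrow> real"
  Qmin :: "'n \<Rightarrow> real"
  Qmax :: "'n \<Rightarrow> real"
  Vmin :: "'n \<Rightarrow> real"
  Vmax :: "'n \<Rightarrow> real"
  Vline :: "'n set \<Rightarrow> real"
  cost2 :: "'n \<Rightarrow> real"
  cost1 :: "'n \<Rightarrow> real"

definition all_lines :: "'n network \<Rightarrow> 'n set set" where
  "all_lines net = sw_lines net \<union> fixed_lines net"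

definition valid_network :: "'n network \<Rightarrow> bool" where
  "valid_network net \<longleftrightarrow>
     gen_buses net \<union> load_buses net = UNIV \<and>
     (\<forall>l\<in>all_lines net. card l = 2) \<and>
     sw_lines net \<inter> fixed_lines net = {} \<and>
     bij_betw (\<lambda>(i, k). {i, k}) (orient net) (sw_lines net) \<and>
     (\<forall>i\<in>gen_buses net. 0 \<le> cost2 net i)"

definition sw_nbrs :: "'n network \<Rightarrow> 'n \<Rightarrow> 'n set" where
  "sw_nbrs net i = {k. {i, k} \<in> sw_lines net}"

text \<open>The end nodes of the switchable line \<open>{i, k}\<close>, in the order given by the orientation.\<close>

definition ends :: "'n network \<Rightarrow> 'n \<Rightarrow> 'n \<Rightarrow> 'n \<times> 'n" where
  "ends net i k = (if (i, k) \<in> orient net then (i, k) else (k, i))"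

section \<open>The matrices of the power flow equations\<close>

text \<open>Admittance matrix of the network that consists of the non-switchable lines only.\<close>

definition Ymat :: "'n::finite network \<Rightarrow> complex^'n^'n" where
  "Ymat net = (\<chi> a b.
     if a = b then (\<Sum>k | {a, k} \<in> fixed_lines net. adm net {a, k})
     else if {a, b} \<in> fixed_lines net then - adm net {a, b} else 0)"

definition Mnode :: "'n::finite \<Rightarrow> complex^'n^'n" where
  "Mnode i = outer (axis i 1) (axis i 1)"

definition Mline :: "'n::finite \<Rightarrow> 'n \<Rightarrow> complex^'n^'n" where
  "Mline i k = outer (axis i 1 - axis k 1) (axis i 1 - axis k 1)"

definition Mhat :: "complex^2^2" where
  "Mhat = vector [vector [1, -1], vector [-1, 1]]"

definition Ynode :: "'n::finite network \<Rightarrow> 'n \<Rightarrow> complex^'n^'n" where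
  "Ynode net i = cscale (1 / 2)
     (cadjoint (Mnode i ** Ymat net) + Mnode i ** Ymat net)"

definition Ynode_bar :: "'n::finite network \<Rightarrow> 'n \<Rightarrow> complex^'n^'n" where
  "Ynode_bar net i = cscale (1 / (2 * \<i>))
     (cadjoint (Mnode i ** Ymat net) - Mnode i ** Ymat net)"

definition Yline :: "'n network \<Rightarrow> 'n \<Rightarrow> 'n \<Rightarrow> complex^'n^'n" where
  "Yline net i k = (\<chi> a b.
     if a = i \<and> b = i then of_real (Re (adm net {i, k}))
     else if a = i \<and> b = k then - adm net {i, k} / 2
     else if a = k \<and> b = i then cnj (- adm net {i, k} / 2)
     else 0)"

definition Yline_bar :: "'n network \<Rightarrow> 'n \<Rightarrow> 'n \<Rightarrow> complex^'n^'n" where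
  "Yline_bar net i k = (\<chi> a b.
     if a = i \<and> b = i then of_real (- Im (adm net {i, k}))
     else if a = i \<and> b = k then - \<i> * adm net {i, k} / 2
     else if a = k \<and> b = i then cnj (- \<i> * adm net {i, k} / 2)
     else 0)"

definition Yhat :: "'n::finite network \<Rightarrow> 'n \<Rightarrow> 'n \<Rightarrow> complex^2^2" where
  "Yhat net i k = (case ends net i k of (u, v) \<Rightarrow> submat2 u v (Yline net i k))"

definition Yhat_bar :: "'n::finite network \<Rightarrow> 'n \<Rightarrow> 'n \<Rightarrow> complex^2^2" where
  "Yhat_bar net i k = (case ends net i k of (u, v) \<Rightarrow> submat2 u v (Yline_bar net i k))"

lemma trace_hermitian_real:
  fixes A B :: "complex^'n^'n"
  assumes "hermitian A" "hermitian B"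
  shows "trace (A ** B) \<in> \<real>"
proof -
  have A: "cnj (A $ a $ b) = A $ b $ a" for a b
    using assms(1) by (simp add: hermitian_def cadjoint_def vec_eq_iff)
  have B: "cnj (B $ a $ b) = B $ b $ a" for a b
    using assms(2) by (simp add: hermitian_def cadjoint_def vec_eq_iff)
  have "cnj (trace (A ** B)) = (\<Sum>a\<in>UNIV. \<Sum>b\<in>UNIV. A $ b $ a * B $ a $ b)"
    by (simp add: trace_def matrix_matrix_mult_def A B)
  also have "\<dots> = trace (A ** B)"
    unfolding trace_def matrix_matrix_mult_def by (subst sum.swap) simp
  finally show ?thesis by (simp add: Reals_cnj_iff)
qed

lemma hermitian_submat2: "hermitian A \<Longrightarrow> hermitian (submat2 i k A)"
  by (auto simp: hermitian_def cadjoint_def submat2_def vec_eq_iff)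

lemma hermitian_cscale_adjoint:
  fixes A :: "complex^'n^'n"
  shows "hermitian (cscale (1 / 2) (cadjoint A + A))"
    and "hermitian (cscale (1 / (2 * \<i>)) (cadjoint A - A))"
  by (simp_all add: hermitian_def cadjoint_def cscale_def vec_eq_iff complex_eq_iff)
    (simp add: field_simps)

lemma hermitian_Ynode: "hermitian (Ynode net i)" "hermitian (Ynode_bar net i)"
  by (simp_all only: Ynode_def Ynode_bar_def hermitian_cscale_adjoint)

lemma hermitian_Yline: "hermitian (Yline net i k)" "hermitian (Yline_bar net i k)"
  unfolding hermitian_def cadjoint_def Yline_def Yline_bar_def vec_eq_iff vec_lambda_beta
  by (auto simp only: if_distrib[of cnj] complex_cnj_cnj complex_cnj_complex_of_real
      complex_cnj_zero split: if_split)

lemma hermitian_Yhat: "hermitian (Yhat net i k)" "hermitian (Yhat_bar net i k)"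
  by (simp_all add: Yhat_def Yhat_bar_def hermitian_submat2 hermitian_Yline split: prod.split)

lemma hermitian_M: "hermitian (Mnode i)" "hermitian (Mline i k)" "hermitian Mhat"
  by (simp_all add: hermitian_def cadjoint_def Mnode_def Mline_def Mhat_def outer_def vec_eq_iff
      axis_def forall_2)

section \<open>The optimization problems\<close>

definition gen_cost :: "'n network \<Rightarrow> ('n \<Rightarrow> real) \<Rightarrow> real" where
  "gen_cost net P = (\<Sum>i\<in>gen_buses net. cost2 net i * (P i)\<^sup>2 + cost1 net i * P i)"

definition box_constraints ::
  "'n::finite network \<Rightarrow> complex^'n^'n \<Rightarrow> ('n \<Rightarrow> real) \<Rightarrow> ('n \<Rightarrow> real) \<Rightarrow> bool" where
  "box_constraints net W P Q \<longleftrightarrow>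
     (\<forall>i. Pmin net i \<le> P i \<and> P i \<le> Pmax net i \<and>
          Qmin net i \<le> Q i \<and> Q i \<le> Qmax net i \<and>
          (Vmin net i)\<^sup>2 \<le> rtr (Mnode i) W \<and> rtr (Mnode i) W \<le> (Vmax net i)\<^sup>2) \<and>
     (\<forall>i k. {i, k} \<in> all_lines net \<longrightarrow> rtr (Mline i k) W \<le> Vline net {i, k})"

definition P_switch ::
  "'n::finite network \<Rightarrow> complex^'n^'n \<Rightarrow> ('n set \<Rightarrow> real) \<Rightarrow> 'n \<Rightarrow> real" where
  "P_switch net W \<alpha> i = rtr (Ynode net i) W + PD net i +
     (\<Sum>k\<in>sw_nbrs net i. \<alpha> {i, k} * rtr (Yline net i k) W)"

definition Q_switch ::
  "'n::finite network \<Rightarrow> complex^'n^'n \<Rightarrow> ('n set \<Rightarrow> real) \<Rightarrow> 'n \<Rightarrow> real" where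
  "Q_switch net W \<alpha> i = rtr (Ynode_bar net i) W + QD net i +
     (\<Sum>k\<in>sw_nbrs net i. \<alpha> {i, k} * rtr (Yline_bar net i k) W)"

definition binary_switching :: "'n network \<Rightarrow> ('n set \<Rightarrow> real) \<Rightarrow> bool" where
  "binary_switching net \<alpha> \<longleftrightarrow> (\<forall>l\<in>sw_lines net. \<alpha> l \<in> {0, 1})"

definition P2_feasible ::
  "'n::finite network \<Rightarrow> (complex^'n^'n) \<times> ('n set \<Rightarrow> real) \<Rightarrow> bool" where
  "P2_feasible net = (\<lambda>(W, \<alpha>). psd W \<and> binary_switching net \<alpha> \<and>
     box_constraints net W (P_switch net W \<alpha>) (Q_switch net W \<alpha>))"

definition P2_cost ::
  "'n::finite network \<Rightarrow> (complex^'n^'n) \<times> ('n set \<Rightarrow> real) \<Rightarrow> real" where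
  "P2_cost net = (\<lambda>(W, \<alpha>). gen_cost net (P_switch net W \<alpha>))"

text \<open>Problem (P1)-\<open>\<alpha>\<close>; it is meant for \<open>\<alpha>\<close> with \<open>binary_switching net \<alpha>\<close>.\<close>

definition P1_feasible ::
  "'n::finite network \<Rightarrow> ('n set \<Rightarrow> real) \<Rightarrow> complex^'n^'n \<Rightarrow> bool" where
  "P1_feasible net \<alpha> W \<longleftrightarrow> psd W \<and>
     box_constraints net W (P_switch net W \<alpha>) (Q_switch net W \<alpha>)"

definition P1_cost ::
  "'n::finite network \<Rightarrow> ('n set \<Rightarrow> real) \<Rightarrow> complex^'n^'n \<Rightarrow> real" where
  "P1_cost net \<alpha> W = gen_cost net (P_switch net W \<alpha>)"

text \<open>In (P3) the matrix \<open>U (i, k)\<close> matters for \<open>(i, k) \<in> orient net\<close> only.\<close>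

definition P_lifted ::
  "'n::finite network \<Rightarrow> complex^'n^'n \<Rightarrow> ('n \<times> 'n \<Rightarrow> complex^2^2) \<Rightarrow> 'n \<Rightarrow> real" where
  "P_lifted net W U i = rtr (Ynode net i) W + PD net i +
     (\<Sum>k\<in>sw_nbrs net i. rtr (Yhat net i k) (U (ends net i k)))"

definition Q_lifted ::
  "'n::finite network \<Rightarrow> complex^'n^'n \<Rightarrow> ('n \<times> 'n \<Rightarrow> complex^2^2) \<Rightarrow> 'n \<Rightarrow> real" where
  "Q_lifted net W U i = rtr (Ynode_bar net i) W + QD net i +
     (\<Sum>k\<in>sw_nbrs net i. rtr (Yhat_bar net i k) (U (ends net i k)))"

definition P3_feasible ::
  "'n::finite network \<Rightarrow> (complex^'n^'n) \<times> ('n \<times> 'n \<Rightarrow> complex^2^2) \<Rightarrow> bool" where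
  "P3_feasible net = (\<lambda>(W, U). psd W \<and>
     box_constraints net W (P_lifted net W U) (Q_lifted net W U) \<and>
     (\<forall>(i, k)\<in>orient net. psd (U (i, k)) \<and>
        Re (U (i, k) $ 1 $ 1) \<le> rtr (Mnode i) W \<and>
        Re (U (i, k) $ 2 $ 2) \<le> rtr (Mnode k) W \<and>
        rtr Mhat (U (i, k)) \<le> rtr (Mline i k) W))"

definition P3_cost ::
  "'n::finite network \<Rightarrow> (complex^'n^'n) \<times> ('n \<times> 'n \<Rightarrow> complex^2^2) \<Rightarrow> real" where
  "P3_cost net = (\<lambda>(W, U). gen_cost net (P_lifted net W U))"

text \<open>The infimum over the empty set in \<^typ>\<open>ereal\<close> is \<open>\<infinity>\<close>. Optimal solutions are
  expressed by \<^const>\<open>is_arg_min\<close>.\<close>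

definition opt_value :: "('x \<Rightarrow> real) \<Rightarrow> ('x \<Rightarrow> bool) \<Rightarrow> ereal" where
  "opt_value f feas = (INF x\<in>{x. feas x}. ereal (f x))"

text \<open>\<open>b\<close> is a number in \<open>{0, 1}\<close> closest to \<open>x\<close>; for \<open>x = 1 / 2\<close> both numbers are admitted.\<close>

definition rounds_to :: "real \<Rightarrow> real \<Rightarrow> bool" where
  "rounds_to x b \<longleftrightarrow> is_arg_min (\<lambda>b. \<bar>b - x\<bar>) (\<lambda>b. b \<in> {0, 1}) b"

end

theory Submission
  imports Defs
begin

text \<open>
  The inequality \<open>p\<^sub>1 \<ge> p\<^sub>2\<close> holds because (P1)-\<open>\<alpha>\<close> is (P2) with its binary variables fixed at
  \<open>\<alpha>\<close>. The inequality \<open>p\<^sub>2 \<ge> p\<^sub>3\<close> holds because (P3) relaxes (P2): a feasible point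
  \<open>(W, \<alpha>)\<close> of (P2) is sent to \<open>(W, U)\<close> with \<open>U\<^sub>i\<^sub>k = \<alpha>\<^sub>i\<^sub>k W\<^sub>i\<^sub>k\<close>, where \<open>W\<^sub>i\<^sub>k\<close> is the principal
  submatrix of \<open>W\<close> on the ends of the line (\<open>switched_blocks\<close>). Since a line matrix vanishes
  off the rows and columns of the ends of its line, its trace against \<open>W\<close> sees only this
  submatrix (\<open>rtr_submat2\<close>). Hence the injections, and with them the box constraints and the
  cost, are unchanged (\<open>lifted_switched_blocks\<close>). The coupling inequalities between \<open>U\<^sub>i\<^sub>k\<close> and
  \<open>W\<close> all have the form \<open>\<alpha> t \<le> t\<close>, where \<open>\<alpha> \<le> 1\<close> and \<open>t\<close> is a value of the positive
  semidefinite form of \<open>W\<close> (\<open>P3_feasible_switched_blocks\<close>).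

  If \<open>p\<^sub>1 = p\<^sub>3\<close>, all three values coincide, so an optimal solution of (P1)-\<open>\<alpha>\<close>, which is
  feasible for (P2) at the same cost, attains \<open>p\<^sub>2\<close>.

  The ratio of traces lies in \<open>[0, 1]\<close> at every feasible point of (P3), because the diagonal of
  \<open>U\<^sub>i\<^sub>k\<close> is nonnegative and dominated by that of \<open>W\<^sub>i\<^sub>k\<close>.
\<close>

section \<open>Principal submatrices on two rows and columns\<close>

lemma sum_two_support:
  fixes f :: "'n::finite \<Rightarrow> 'a::comm_monoid_add"
  assumes "i \<noteq> k" and "\<And>a. a \<notin> {i, k} \<Longrightarrow> f a = 0"
  shows "sum f UNIV = f i + f k"
proof -
  have "sum f UNIV = sum f {i, k}"
    by (rule sum.mono_neutral_right) (use assms(2) in auto)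
  then show ?thesis using assms(1) by simp
qed

lemma rtr_submat2:
  fixes A W :: "complex^'n::finite^'n"
  assumes "i \<noteq> k" and zero: "\<And>a b. a \<notin> {i, k} \<or> b \<notin> {i, k} \<Longrightarrow> A $ a $ b = 0"
  shows "rtr (submat2 i k A) (submat2 i k W) = rtr A W"
proof -
  have "trace (A ** W) = (\<Sum>a\<in>UNIV. \<Sum>b\<in>UNIV. A $ a $ b * W $ b $ a)"
    by (simp add: trace_def matrix_matrix_mult_def)
  also have "\<dots> = (\<Sum>a\<in>UNIV. A $ a $ i * W $ i $ a + A $ a $ k * W $ k $ a)"
    by (intro sum.cong refl sum_two_support assms(1)) (simp add: zero)
  also have "\<dots> = A $ i $ i * W $ i $ i + A $ i $ k * W $ k $ i
      + (A $ k $ i * W $ i $ k + A $ k $ k * W $ k $ k)"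
    by (intro sum_two_support assms(1)) (simp add: zero)
  also have "\<dots> = trace (submat2 i k A ** submat2 i k W)"
    by (simp add: trace_def matrix_matrix_mult_def submat2_def sum_2)
  finally show ?thesis by (simp add: rtr_def)
qed

lemma rtr_cscale: "rtr A (cscale (of_real r) B) = r * rtr A B"
proof -
  have "trace (A ** cscale (of_real r) B) = of_real r * trace (A ** B)"
    by (simp add: trace_def matrix_matrix_mult_def cscale_def sum_distrib_left mult.left_commute)
  then show ?thesis by (simp add: rtr_def)
qed

lemma rtr_Mnode: "rtr (Mnode i) W = Re (W $ i $ i)"
proof -
  have "(\<Sum>b\<in>UNIV. Mnode i $ a $ b * W $ b $ a)
      = (\<Sum>b\<in>UNIV. if b = i then (if a = i then W $ i $ i else 0) else 0)" for a
    by (rule sum.cong) (auto simp: Mnode_def outer_def axis_def)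
  then show ?thesis by (simp add: rtr_def trace_def matrix_matrix_mult_def)
qed

lemma Mhat_eq_submat2:
  assumes "i \<noteq> k"
  shows "Mhat = submat2 i k (Mline i k)"
  using assms by (simp add: Mhat_def submat2_def Mline_def outer_def axis_def vec_eq_iff forall_2)

section \<open>Positive semidefinite matrices\<close>

text \<open>For a real vector \<open>v\<close> the trace of \<open>v v\<^sup>T W\<close> is the value at \<open>v\<close> of the form of \<open>W\<close>; the
  node and line matrices are of the shape \<open>v v\<^sup>T\<close>.\<close>

lemma rtr_outer_nonneg:
  fixes W :: "complex^'n::finite^'n"
  assumes "psd W" and real: "\<And>a. cnj (v $ a) = v $ a"
  shows "0 \<le> rtr (outer v v) W"
proof -
  have "trace (outer v v ** W) = (\<Sum>a\<in>UNIV. \<Sum>b\<in>UNIV. v $ a * v $ b * W $ b $ a)"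
    by (simp add: trace_def matrix_matrix_mult_def outer_def)
  also have "\<dots> = (\<Sum>b\<in>UNIV. \<Sum>a\<in>UNIV. v $ a * v $ b * W $ b $ a)"
    by (rule sum.swap)
  also have "\<dots> = (\<Sum>b\<in>UNIV. cnj (v $ b) * (W *v v) $ b)"
    by (simp add: real matrix_vector_mult_def sum_distrib_left ac_simps)
  finally show ?thesis using assms(1) by (simp only: psd_def rtr_def)
qed

lemma rtr_Mnode_nonneg: "psd W \<Longrightarrow> 0 \<le> rtr (Mnode i) W"
  unfolding Mnode_def by (rule rtr_outer_nonneg) (simp_all add: axis_def)

lemma rtr_Mline_nonneg: "psd W \<Longrightarrow> 0 \<le> rtr (Mline i k) W"
  unfolding Mline_def by (rule rtr_outer_nonneg) (simp_all add: axis_def)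

lemma psd_submat2:
  fixes W :: "complex^'n::finite^'n"
  assumes "psd W" and "i \<noteq> k"
  shows "psd (submat2 i k W)"
  unfolding psd_def
proof (intro conjI allI)
  show "hermitian (submat2 i k W)"
    using assms(1) by (simp add: psd_def hermitian_submat2)
  fix x :: "complex^2"
  define z :: "complex^'n"
    where "z = (\<chi> a. if a = i then x $ 1 else if a = k then x $ 2 else 0)"
  have Wz: "(W *v z) $ a = W $ a $ i * x $ 1 + W $ a $ k * x $ 2" for a
  proof -
    have "(W *v z) $ a = W $ a $ i * z $ i + W $ a $ k * z $ k"
      unfolding matrix_vector_mult_def vec_lambda_beta
      by (rule sum_two_support[OF assms(2)]) (simp add: z_def)
    then show ?thesis using assms(2) by (simp add: z_def)
  qed
  have "(\<Sum>a\<in>UNIV. cnj (z $ a) * (W *v z) $ a)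
      = cnj (z $ i) * (W *v z) $ i + cnj (z $ k) * (W *v z) $ k"
    by (rule sum_two_support[OF assms(2)]) (simp add: z_def)
  also have "\<dots> = (\<Sum>a\<in>UNIV. cnj (x $ a) * (submat2 i k W *v x) $ a)"
    unfolding Wz using assms(2)
    by (simp add: z_def sum_2 matrix_vector_mult_def submat2_def)
  finally show "0 \<le> Re (\<Sum>a\<in>UNIV. cnj (x $ a) * (submat2 i k W *v x) $ a)"
    using assms(1) by (metis psd_def)
qed

lemma psd_cscale:
  assumes "psd A" and "0 \<le> r"
  shows "psd (cscale (of_real r) A)"
  unfolding psd_def
proof (intro conjI allI)
  show "hermitian (cscale (of_real r) A)"
    using assms(1) by (simp add: psd_def hermitian_def cadjoint_def cscale_def vec_eq_iff)
  fix x
  have "(\<Sum>a\<in>UNIV. cnj (x $ a) * (cscale (of_real r) A *v x) $ a)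
      = of_real r * (\<Sum>a\<in>UNIV. cnj (x $ a) * (A *v x) $ a)"
    by (simp add: matrix_vector_mult_def cscale_def sum_distrib_left ac_simps)
  then show "0 \<le> Re (\<Sum>a\<in>UNIV. cnj (x $ a) * (cscale (of_real r) A *v x) $ a)"
    using assms by (simp add: psd_def)
qed

section \<open>The third problem relaxes the second\<close>

text \<open>The blocks follow the order of the pair, so that a line matrix is compared with \<open>W\<close> on the
  same ordered pair of rows whichever way its line is oriented.\<close>

definition switched_blocks ::
  "complex^'n^'n \<Rightarrow> ('n set \<Rightarrow> real) \<Rightarrow> 'n \<times> 'n \<Rightarrow> complex^2^2" where
  "switched_blocks W \<alpha> = (\<lambda>(u, v). cscale (of_real (\<alpha> {u, v})) (submat2 u v W))"

lemma valid_network_line_ends: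
  assumes "valid_network net" and "{i, k} \<in> sw_lines net"
  shows "i \<noteq> k"
proof -
  have "card {i, k} = 2"
    using assms by (auto simp: valid_network_def all_lines_def)
  then show ?thesis by auto
qed

lemma valid_network_orient:
  assumes "valid_network net"
  shows "(\<lambda>(i, k). {i, k}) ` orient net = sw_lines net"
  using assms by (simp add: valid_network_def bij_betw_def)

lemma valid_network_oriented_line:
  assumes "valid_network net" and "(i, k) \<in> orient net"
  shows "{i, k} \<in> sw_lines net"
  using valid_network_orient[OF assms(1)] assms(2) by force

lemma lifted_switched_blocks:
  assumes "valid_network net"
  shows "P_lifted net W (switched_blocks W \<alpha>) = P_switch net W \<alpha>"
    and "Q_lifted net W (switched_blocks W \<alpha>) = Q_switch net W \<alpha>"
proof -
  have "rtr (Yhat net i k) (switched_blocks W \<alpha> (ends net i k))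
        = \<alpha> {i, k} * rtr (Yline net i k) W" and
    "rtr (Yhat_bar net i k) (switched_blocks W \<alpha> (ends net i k))
        = \<alpha> {i, k} * rtr (Yline_bar net i k) W" if "k \<in> sw_nbrs net i" for i k
  proof -
    have ne: "i \<noteq> k"
      using valid_network_line_ends[OF assms] that by (simp add: sw_nbrs_def)
    obtain u v where uv: "ends net i k = (u, v)" by (cases "ends net i k")
    then have "(u, v) = (i, k) \<or> (u, v) = (k, i)" by (auto simp: ends_def split: if_splits)
    then have "u \<noteq> v" and line: "{u, v} = {i, k}" using ne by auto
    have "rtr (submat2 u v (Yline net i k)) (submat2 u v W) = rtr (Yline net i k) W"
      and "rtr (submat2 u v (Yline_bar net i k)) (submat2 u v W) = rtr (Yline_bar net i k) W"
      by (rule rtr_submat2[OF \<open>u \<noteq> v\<close>, unfolded line];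
          auto simp only: Yline_def Yline_bar_def vec_lambda_beta insert_iff split: if_split)+
    then show "rtr (Yhat net i k) (switched_blocks W \<alpha> (ends net i k))
        = \<alpha> {i, k} * rtr (Yline net i k) W"
      and "rtr (Yhat_bar net i k) (switched_blocks W \<alpha> (ends net i k))
        = \<alpha> {i, k} * rtr (Yline_bar net i k) W"
      by (simp_all add: uv switched_blocks_def Yhat_def Yhat_bar_def rtr_cscale line)
  qed
  then show "P_lifted net W (switched_blocks W \<alpha>) = P_switch net W \<alpha>"
    and "Q_lifted net W (switched_blocks W \<alpha>) = Q_switch net W \<alpha>"
    by (auto simp: fun_eq_iff P_lifted_def P_switch_def Q_lifted_def Q_switch_def)
qed

text \<open>Of the bounds \<open>0 \<le> \<alpha> \<le> 1\<close>, the lower one makes the blocks positive semidefinite and the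
  upper one gives the coupling inequalities, the traces against \<open>W\<close> being nonnegative.\<close>

lemma P3_feasible_switched_blocks:
  assumes net: "valid_network net" and feas: "P2_feasible net (W, \<alpha>)"
  shows "P3_feasible net (W, switched_blocks W \<alpha>)"
proof -
  have W: "psd W" and \<alpha>: "binary_switching net \<alpha>"
    and box: "box_constraints net W (P_switch net W \<alpha>) (Q_switch net W \<alpha>)"
    using feas by (auto simp: P2_feasible_def)
  have "psd (switched_blocks W \<alpha> (i, k)) \<and>
      Re (switched_blocks W \<alpha> (i, k) $ 1 $ 1) \<le> rtr (Mnode i) W \<and>
      Re (switched_blocks W \<alpha> (i, k) $ 2 $ 2) \<le> rtr (Mnode k) W \<and>
      rtr Mhat (switched_blocks W \<alpha> (i, k)) \<le> rtr (Mline i k) W"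
    if "(i, k) \<in> orient net" for i k
  proof -
    have line: "{i, k} \<in> sw_lines net" by (rule valid_network_oriented_line[OF net that])
    then have ne: "i \<noteq> k" by (rule valid_network_line_ends[OF net])
    have "\<alpha> {i, k} \<in> {0, 1}" using line \<alpha> by (auto simp: binary_switching_def)
    then have range: "0 \<le> \<alpha> {i, k}" "\<alpha> {i, k} \<le> 1" by auto
    have shrink: "\<alpha> {i, k} * t \<le> t" if "0 \<le> t" for t
      using range that by (simp add: mult_left_le_one_le)
    have "rtr Mhat (submat2 i k W) = rtr (Mline i k) W"
      unfolding Mhat_eq_submat2[OF ne]
      by (rule rtr_submat2[OF ne]) (auto simp: Mline_def outer_def axis_def)
    moreover have "Re (switched_blocks W \<alpha> (i, k) $ 1 $ 1) = \<alpha> {i, k} * rtr (Mnode i) W"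
      and "Re (switched_blocks W \<alpha> (i, k) $ 2 $ 2) = \<alpha> {i, k} * rtr (Mnode k) W"
      by (simp_all add: switched_blocks_def cscale_def submat2_def rtr_Mnode)
    ultimately show ?thesis
      using shrink rtr_Mnode_nonneg[OF W] rtr_Mline_nonneg[OF W]
        psd_cscale[OF psd_submat2[OF W ne] range(1)]
      by (simp add: rtr_cscale switched_blocks_def)
  qed
  then show ?thesis
    using W box by (auto simp: P3_feasible_def lifted_switched_blocks[OF net])
qed

section \<open>Comparison of the optimal values\<close>

lemma opt_value_le:
  assumes "\<And>x. F x \<Longrightarrow> G (h x) \<and> g (h x) = f x"
  shows "opt_value g G \<le> opt_value f F"
  unfolding opt_value_def
proof (rule INF_greatest)
  fix x assume "x \<in> {x. F x}"
  then have "G (h x)" and "g (h x) = f x" using assms by auto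
  then show "(INF x\<in>{x. G x}. ereal (g x)) \<le> ereal (f x)"
    by (intro INF_lower2[of "h x"]) auto
qed

lemma opt_value_attained:
  fixes f :: "'x \<Rightarrow> real"
  assumes "F x"
  shows "is_arg_min f F x \<longleftrightarrow> opt_value f F = ereal (f x)"
proof
  assume "is_arg_min f F x"
  then show "opt_value f F = ereal (f x)"
    unfolding opt_value_def by (intro INF_eqI) (auto simp: is_arg_min_linorder)
next
  assume eq: "opt_value f F = ereal (f x)"
  have "f x \<le> f y" if "F y" for y
  proof -
    have "opt_value f F \<le> ereal (f y)"
      unfolding opt_value_def by (rule INF_lower) (use that in auto)
    then show ?thesis by (simp add: eq)
  qed
  then show "is_arg_min f F x" using assms by (simp add: is_arg_min_linorder)
qed

lemma opt_value_P2_le_P1: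
  assumes "binary_switching net \<alpha>"
  shows "opt_value (P2_cost net) (P2_feasible net)
    \<le> opt_value (P1_cost net \<alpha>) (P1_feasible net \<alpha>)"
  by (rule opt_value_le[where h = "\<lambda>W. (W, \<alpha>)"])
    (use assms in \<open>auto simp: P1_feasible_def P2_feasible_def P1_cost_def P2_cost_def\<close>)

lemma opt_value_P3_le_P2:
  assumes "valid_network net"
  shows "opt_value (P3_cost net) (P3_feasible net) \<le> opt_value (P2_cost net) (P2_feasible net)"
  by (rule opt_value_le[where h = "\<lambda>(W, \<alpha>). (W, switched_blocks W \<alpha>)"])
    (auto simp: P3_feasible_switched_blocks[OF assms] P3_cost_def P2_cost_def
      lifted_switched_blocks[OF assms])

text \<open>Division by zero yields \<open>0\<close>, so the claim also covers lines at both ends of which the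
  voltage vanishes.\<close>

lemma trace_ratio_in_unit_interval:
  assumes feas: "P3_feasible net (W, U)" and line: "(i, k) \<in> orient net"
  shows "Re (trace (U (i, k))) / Re (trace (submat2 i k W)) \<in> {0..1}"
proof -
  have U: "psd (U (i, k))" "Re (U (i, k) $ 1 $ 1) \<le> rtr (Mnode i) W"
    "Re (U (i, k) $ 2 $ 2) \<le> rtr (Mnode k) W"
    using feas line by (auto simp: P3_feasible_def)
  have "0 \<le> Re (U (i, k) $ a $ a)" for a
    using rtr_Mnode_nonneg[OF U(1), of a] by (simp add: rtr_Mnode)
  then have "0 \<le> Re (trace (U (i, k)))" by (simp add: trace_def sum_2)
  moreover have "Re (trace (U (i, k))) \<le> Re (trace (submat2 i k W))"
    using U(2,3) by (simp add: trace_def sum_2 submat2_def rtr_Mnode)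
  ultimately show ?thesis by (auto simp: divide_le_eq_1)
qed

lemma rounded_binary_switching:
  assumes "valid_network net"
    and "\<forall>(i, k)\<in>orient net. rounds_to (\<alpha>' {i, k}) (\<alpha> {i, k})"
  shows "binary_switching net \<alpha>"
  unfolding binary_switching_def valid_network_orient[OF assms(1), symmetric]
  using assms(2) by (auto simp: rounds_to_def is_arg_min_def)

theorem mainTheorem5:
  fixes net :: "'n::finite network"
    and W3 :: "complex^'n^'n"
    and U3 :: "'n \<times> 'n \<Rightarrow> complex^2^2"
    and \<alpha>hat \<alpha>r :: "'n set \<Rightarrow> real"
  assumes "valid_network net"
    and "is_arg_min (P3_cost net) (P3_feasible net) (W3, U3)"
    and "\<forall>(i, k)\<in>orient net.
           \<alpha>hat {i, k} = Re (trace (U3 (i, k))) / Re (trace (submat2 i k W3))"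
    and "\<forall>(i, k)\<in>orient net. rounds_to (\<alpha>hat {i, k}) (\<alpha>r {i, k})"
  shows "(\<forall>(i, k)\<in>orient net. \<alpha>hat {i, k} \<in> {0..1}) \<and>
    opt_value (P1_cost net \<alpha>r) (P1_feasible net \<alpha>r) \<ge> opt_value (P2_cost net) (P2_feasible net) \<and>
    opt_value (P2_cost net) (P2_feasible net) \<ge> opt_value (P3_cost net) (P3_feasible net) \<and>
    (opt_value (P1_cost net \<alpha>r) (P1_feasible net \<alpha>r) = opt_value (P3_cost net) (P3_feasible net) \<longrightarrow>
      (\<forall>W1. is_arg_min (P1_cost net \<alpha>r) (P1_feasible net \<alpha>r) W1 \<longrightarrow>
        is_arg_min (P2_cost net) (P2_feasible net) (W1, \<alpha>r)))"
proof -
  let ?p1 = "opt_value (P1_cost net \<alpha>r) (P1_feasible net \<alpha>r)"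
  let ?p2 = "opt_value (P2_cost net) (P2_feasible net)"
  let ?p3 = "opt_value (P3_cost net) (P3_feasible net)"
  have bin: "binary_switching net \<alpha>r"
    by (rule rounded_binary_switching[OF assms(1,4)])
  have "P3_feasible net (W3, U3)" using assms(2) by (simp add: is_arg_min_def)
  then have range: "\<forall>(i, k)\<in>orient net. \<alpha>hat {i, k} \<in> {0..1}"
    using assms(3) trace_ratio_in_unit_interval by fastforce
  have p12: "?p2 \<le> ?p1" by (rule opt_value_P2_le_P1[OF bin])
  have p23: "?p3 \<le> ?p2" by (rule opt_value_P3_le_P2[OF assms(1)])
  have "is_arg_min (P2_cost net) (P2_feasible net) (W1, \<alpha>r)"
    if "?p1 = ?p3" and W1: "is_arg_min (P1_cost net \<alpha>r) (P1_feasible net \<alpha>r) W1" for W1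
  proof -
    have feas: "P1_feasible net \<alpha>r W1" using W1 by (simp add: is_arg_min_def)
    then have feas2: "P2_feasible net (W1, \<alpha>r)"
      using bin by (simp add: P1_feasible_def P2_feasible_def)
    have "?p2 = ?p1" using p12 p23 that(1) by simp
    also have "\<dots> = ereal (P2_cost net (W1, \<alpha>r))"
      using W1 by (simp add: opt_value_attained[of "P1_feasible net \<alpha>r", OF feas]
          P1_cost_def P2_cost_def)
    finally show ?thesis by (simp add: opt_value_attained[of "P2_feasible net", OF feas2])
  qed
  with range p12 p23 show ?thesis by blast
qed

end
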